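(* Let $\mathcal{A}(t,\xi)=[a_{j,k}(t,\xi)]$ be an $m\times m$ matrix with $a_{j,k}\in C^\infty(\mathbb{T}\times\mathbb{Z}^n)$. Assume that its eigenvalues $\lambda_1(t,\xi),\dots,\lambda_m(t,\xi)$ and eigenvectors $h_1(t,\xi),\dots,h_{m-1}(t,\xi)$ corresponding to $\lambda_1,\dots,\lambda_{m-1}$ are also smooth on $\mathbb{T}\times\mathbb{Z}^n$ and that $$\langle h^{(i)}(t,\xi),e_1\rangle\ne0,\quad\forall(t,\xi)\in\mathbb{T}\times\mathbb{Z}^n,$$ holds for all $i=1,\dots,m-1$, where $e_1=(1,0,\dots,0)\in\mathbb{R}^{m-i+1}$ and the vectors $h^{(i)}$ are those constructed recursively from $h_1,\dots,h_{m-1}$ as described in the context. Then there exist smooth matrices $S(t,\xi)$, invertible for all $(t,\xi)\in\mathbb{T}\times\mathbb{Z}^n$, with smooth inverses $S^{-1}(t,\xi)$, such that $$S^{-1}(t,\xi)\mathcal{A}(t,\xi)S(t,\xi)=\Lambda(t,\xi)+\mathcal{N}(t,\xi)$$ for all $(t,\xi)\in\mathbb{T}\times\mathbb{Z}^n$, where $\Lambda(t,\xi)=\mathrm{diag}(\lambda_1(t,\xi),\dots,\lambda_m(t,\xi))$ and $\mathcal{N}(t,\xi)$ is an upper triangular nilpotent matrix with entries $r_{j,k}(t,\xi)\in C^\infty(\mathbb{T}\times\mathbb{Z}^n)$.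
   Context: $\mathbb{T}=\mathbb{R}/2\pi\mathbb{Z}$. $C^\infty(\mathbb{T}\times\mathbb{Z}^n)=\{f:\mathbb{T}\times\mathbb{Z}^n\to\mathbb{C};\ f(\cdot,\xi)\in C^\infty(\mathbb{T})\ \forall\xi\in\mathbb{Z}^n\}$; a vector or matrix is smooth on $\mathbb{T}\times\mathbb{Z}^n$ if its entries belong to this space. Eigenvalues are listed with multiplicity. Construction of $h^{(i)}$. Let $\pi_k$ be the projection of $m$-vectors onto their last $m-k$ coordinates, $\pi_k(x_1,\dots,x_m)=(x_{k+1},\dots,x_m)$. Set $h^{(1)}=h_1$. For $k\in\{1,\dots,m-1\}$, once $h^{(k)}(t,\xi)\in\mathbb{C}^{m-k+1}$ is defined with $\langle h^{(k)}(t,\xi),e_1\rangle\ne0$ for all $(t,\xi)$, let $\widetilde S_k(t,\xi)$ be the square matrix of order $m-k+1$ whose first column is the vector with coordinates $\langle h^{(k)}(t,\xi),e_j\rangle/\langle h^{(k)}(t,\xi),e_1\rangle$, $j=1,\dots,m-k+1$, and whose remaining columns are the standard basis vectors $e_2,\dots,e_{m-k+1}$ of $\mathbb{R}^{m-k+1}$, and let $$S_k=\begin{bmatrix}I_{k-1}&0\\0&\widetilde S_k\end{bmatrix}$$ (of order $m$, with $S_1=\widetilde S_1$), where $I_{k-1}$ is the identity matrix of order $k-1$. For $i\in\{2,\dots,m-1\}$ set $$h^{(i)}=\pi_{i-1}\left(S_{i-1}^{-1}S_{i-2}^{-1}\cdots S_1^{-1}h_i\right).$$ *)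

theory Defs
  imports
    "HOL-Analysis.Analysis"
    "Jordan_Normal_Form.Char_Poly"
    "Jordan_Normal_Form.Gauss_Jordan_Elimination"
begin

text \<open>
  Matrices and vectors are those of Jordan_Normal_Form (dimensions are natural numbers, entries
  are indexed from 0). Functions on the torus $R / 2 \pi Z$ are $2\pi$-periodic functions on the
  real line; $Z^n$ is the type of integer vectors over a finite index type.
\<close>

unbundle no vec_syntax
unbundle no inner_syntax
hide_const (open) Finite_Cartesian_Product.vec
hide_type (open) Finite_Cartesian_Product.vec

definition smooth_torus :: "(real \<Rightarrow> complex) \<Rightarrow> bool" where
  "smooth_torus f \<longleftrightarrow>
     (\<forall>t. f (t + 2 * pi) = f t) \<and>
     (\<forall>k t. ((\<lambda>g x. vector_derivative g (at x)) ^^ k) f differentiable (at t))"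

definition Cinf_TZ :: "(real \<Rightarrow> int ^ 'n::finite \<Rightarrow> complex) set" where
  "Cinf_TZ = {f. \<forall>\<xi>. smooth_torus (\<lambda>t. f t \<xi>)}"

definition smooth_vec :: "nat \<Rightarrow> (real \<Rightarrow> int ^ 'n::finite \<Rightarrow> complex vec) \<Rightarrow> bool" where
  "smooth_vec m v \<longleftrightarrow>
     (\<forall>t \<xi>. v t \<xi> \<in> carrier_vec m) \<and>
     (\<forall>j<m. (\<lambda>t \<xi>. vec_index (v t \<xi>) j) \<in> Cinf_TZ)"

definition smooth_mat :: "nat \<Rightarrow> (real \<Rightarrow> int ^ 'n::finite \<Rightarrow> complex mat) \<Rightarrow> bool" where
  "smooth_mat m A \<longleftrightarrow>
     (\<forall>t \<xi>. A t \<xi> \<in> carrier_mat m m) \<and>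
     (\<forall>j<m. \<forall>k<m. (\<lambda>t \<xi>. A t \<xi> $$ (j, k)) \<in> Cinf_TZ)"

text \<open>\<open>l 1, \<dots>, l m\<close> lists the eigenvalues of \<open>A\<close>, each according to its algebraic multiplicity
  (which is 0 for a number that is not an eigenvalue).\<close>

definition lists_eigenvalues :: "nat \<Rightarrow> complex mat \<Rightarrow> (nat \<Rightarrow> complex) \<Rightarrow> bool" where
  "lists_eigenvalues m A l \<longleftrightarrow> (\<forall>z. card {i \<in> {1..m}. l i = z} = order z (char_poly A))"

text \<open>Meaningful for invertible matrices only.\<close>

abbreviation inv_mat :: "complex mat \<Rightarrow> complex mat" where
  "inv_mat A \<equiv> the (mat_inverse A)"

definition nilpotent_mat :: "complex mat \<Rightarrow> bool" where
  "nilpotent_mat N \<longleftrightarrow> square_mat N \<and> (\<exists>k. N ^\<^sub>m k = 0\<^sub>m (dim_row N) (dim_row N))"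

text \<open>\<open>S_tilde d v\<close> is the matrix of order \<open>d\<close> built from \<open>v \<in> \<complex>\<^sup>d\<close>, and \<open>S_block m k v\<close> is
  \<open>S\<^sub>k\<close> (of order \<open>m\<close>) when \<open>v = h\<^sup>(\<^sup>k\<^sup>)\<close>. The \<open>j\<close>-th standard basis vector is
  \<open>unit_vec d (j - 1)\<close>.\<close>

definition S_tilde :: "nat \<Rightarrow> complex vec \<Rightarrow> complex mat" where
  "S_tilde d v = mat_of_cols d
     (Matrix.vec d (\<lambda>j. (v \<bullet>c unit_vec d j) / (v \<bullet>c unit_vec d 0)) # map (unit_vec d) [1..<d])"

definition S_block :: "nat \<Rightarrow> nat \<Rightarrow> complex vec \<Rightarrow> complex mat" where
  "S_block m k v = four_block_mat
     (1\<^sub>m (k - 1)) (0\<^sub>m (k - 1) (m - k + 1))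
     (0\<^sub>m (m - k + 1) (k - 1)) (S_tilde (m - k + 1) v)"

text \<open>For \<open>h 1, \<dots>, h (m - 1) \<in> \<complex>\<^sup>m\<close> (the eigenvectors at a fixed point \<open>(t, \<xi>)\<close>),
  \<open>S_inv_prod m h k\<close> is \<open>S\<^sub>k\<inverse> \<cdots> S\<^sub>1\<inverse>\<close>, and \<open>h_rec m h i\<close> is \<open>h\<^sup>(\<^sup>i\<^sup>)\<close>; the last \<open>m - k\<close>
  coordinates of \<open>x\<close> (the projection \<open>\<pi>\<^sub>k\<close>) are \<open>vec_last x (m - k)\<close>.\<close>

primrec S_inv_prod :: "nat \<Rightarrow> (nat \<Rightarrow> complex vec) \<Rightarrow> nat \<Rightarrow> complex mat" where
  "S_inv_prod m h 0 = 1\<^sub>m m"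
| "S_inv_prod m h (Suc k) =
     inv_mat (S_block m (Suc k) (vec_last (S_inv_prod m h k *\<^sub>v h (Suc k)) (m - k))) *
     S_inv_prod m h k"

definition h_rec :: "nat \<Rightarrow> (nat \<Rightarrow> complex vec) \<Rightarrow> nat \<Rightarrow> complex vec" where
  "h_rec m h i = vec_last (S_inv_prod m h (i - 1) *\<^sub>v h i) (m - (i - 1))"

lemma h_rec_1: "h 1 \<in> carrier_vec m \<Longrightarrow> h_rec m h 1 = h 1"
  by (auto simp: h_rec_def vec_last_def)

lemma S_inv_prod_Suc:
  "S_inv_prod m h (Suc k) = inv_mat (S_block m (Suc k) (h_rec m h (Suc k))) * S_inv_prod m h k"
  by (simp add: h_rec_def)

end

theory Submission
  imports Defs
begin

text \<open>
  Suppose that \<open>S\<^sub>k\<inverse> \<cdots> S\<^sub>1\<inverse> A S\<^sub>1 \<cdots> S\<^sub>k\<close> is upper triangular in its first \<open>k\<close>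
  columns, with diagonal entries \<open>\<lambda>\<^sub>1, \<dots>, \<lambda>\<^sub>k\<close> there. Its eigenvector
  \<open>w = S\<^sub>k\<inverse> \<cdots> S\<^sub>1\<inverse> h\<^sub>k\<^sub>+\<^sub>1\<close> has nonzero entry at position \<open>k + 1\<close>, and \<open>S\<^sub>k\<^sub>+\<^sub>1\<close> is the
  Gaussian elimination matrix whose inverse sends the lower part of \<open>w\<close>, scaled to leading entry 1, to a
  unit vector; conjugation by it makes column \<open>k + 1\<close> triangular and keeps the earlier ones. After \<open>m - 1\<close>
  steps the matrix is triangular, and comparing characteristic polynomials gives the last diagonal
  entry \<open>\<lambda>\<^sub>m\<close>. The entries of all \<open>S\<^sub>k\<close> and of their inverses are \<open>0\<close>, \<open>1\<close> or quotients
  \<open>\<plusminus> w\<^sub>i / w\<^sub>k\<^sub>+\<^sub>1\<close> of smooth functions with nonvanishing denominator, hence smooth.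
\<close>

subsection \<open>Smooth functions on the torus\<close>

text \<open>Peeling off the innermost derivative lets the sum, product and quotient rules be proved
  by induction on the order, with the functions left arbitrary.\<close>

primrec n_times_differentiable :: "nat \<Rightarrow> (real \<Rightarrow> 'a::real_normed_vector) \<Rightarrow> bool" where
  "n_times_differentiable 0 f \<longleftrightarrow> True"
| "n_times_differentiable (Suc n) f \<longleftrightarrow>
     (\<forall>t. f differentiable (at t)) \<and> n_times_differentiable n (\<lambda>x. vector_derivative f (at x))"

lemma n_times_differentiable_SucD:
  "n_times_differentiable (Suc n) f \<Longrightarrow> n_times_differentiable n f"
  by (induction n arbitrary: f) auto

text \<open>Derivatives are unique, so an explicit formula, such as one given by the product rule,
  may stand in for \<open>vector_derivative\<close>.\<close>

lemma n_times_differentiable_SucI: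
  assumes "\<And>t. (f has_vector_derivative f' t) (at t)" and "n_times_differentiable n f'"
  shows "n_times_differentiable (Suc n) f"
proof -
  have "(\<lambda>x. vector_derivative f (at x)) = f'"
    using vector_derivative_at[OF assms(1)] by blast
  then show ?thesis
    using assms differentiableI_vector by force
qed

lemma n_times_differentiable_SucE:
  assumes "n_times_differentiable (Suc n) f"
  obtains f' where "\<And>t. (f has_vector_derivative f' t) (at t)" and "n_times_differentiable n f'"
  using assms vector_derivative_works[of f] by force

lemma n_times_differentiable_const: "n_times_differentiable n (\<lambda>t. c)"
proof (induction n arbitrary: c)
  case (Suc n)
  show ?case
    by (rule n_times_differentiable_SucI[where f' = "\<lambda>t. 0"]) (auto simp: Suc)
qed simp

lemma n_times_differentiable_add:
  assumes "n_times_differentiable n f" "n_times_differentiable n g"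
  shows "n_times_differentiable n (\<lambda>t. f t + g t)"
  using assms
proof (induction n arbitrary: f g)
  case (Suc n)
  obtain f' where f': "\<And>t. (f has_vector_derivative f' t) (at t)" "n_times_differentiable n f'"
    using Suc.prems(1) by (rule n_times_differentiable_SucE) blast
  obtain g' where g': "\<And>t. (g has_vector_derivative g' t) (at t)" "n_times_differentiable n g'"
    using Suc.prems(2) by (rule n_times_differentiable_SucE) blast
  show ?case
    by (rule n_times_differentiable_SucI[where f' = "\<lambda>t. f' t + g' t"])
      (auto intro!: has_vector_derivative_add Suc.IH f' g')
qed simp

lemma n_times_differentiable_mult:
  fixes f g :: "real \<Rightarrow> 'a::real_normed_algebra"
  assumes "n_times_differentiable n f" "n_times_differentiable n g"
  shows "n_times_differentiable n (\<lambda>t. f t * g t)"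
  using assms
proof (induction n arbitrary: f g)
  case (Suc n)
  obtain f' where f': "\<And>t. (f has_vector_derivative f' t) (at t)" "n_times_differentiable n f'"
    using Suc.prems(1) by (rule n_times_differentiable_SucE) blast
  obtain g' where g': "\<And>t. (g has_vector_derivative g' t) (at t)" "n_times_differentiable n g'"
    using Suc.prems(2) by (rule n_times_differentiable_SucE) blast
  show ?case
    by (rule n_times_differentiable_SucI[where f' = "\<lambda>t. f t * g' t + f' t * g t"])
      (auto intro!: has_vector_derivative_mult n_times_differentiable_add Suc.IH f' g'
        Suc.prems[THEN n_times_differentiable_SucD])
qed simp

text \<open>The derivative of \<open>1 / f\<close> is \<open>f'\<close> times two copies of
  \<open>1 / f\<close>, up to sign, so regularity of order \<open>n\<close> for \<open>1 / f\<close>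
  yields order \<open>n + 1\<close>.\<close>

lemma n_times_differentiable_inverse:
  fixes f :: "real \<Rightarrow> 'a::real_normed_field"
  assumes "n_times_differentiable n f" and nz: "\<And>t. f t \<noteq> 0"
  shows "n_times_differentiable n (\<lambda>t. inverse (f t))"
  using assms(1)
proof (induction n)
  case (Suc n)
  obtain f' where f': "\<And>t. (f has_vector_derivative f' t) (at t)" "n_times_differentiable n f'"
    using Suc.prems(1) by (rule n_times_differentiable_SucE) blast
  have inv: "n_times_differentiable n (\<lambda>t. inverse (f t))"
    using Suc by (blast dest: n_times_differentiable_SucD)
  have "((\<lambda>t. inverse (f t)) has_vector_derivative f' t * (- 1 * (inverse (f t) * inverse (f t)))) (at t)" for t
    using field_vector_diff_chain_at[OF f'(1) DERIV_inverse[OF nz]]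
    by (simp add: o_def power2_eq_square)
  then show ?case
    by (rule n_times_differentiable_SucI)
      (intro n_times_differentiable_mult n_times_differentiable_const f' inv)
qed simp

lemma smooth_torus_iff:
  "smooth_torus f \<longleftrightarrow> (\<forall>t. f (t + 2 * pi) = f t) \<and> (\<forall>n. n_times_differentiable n f)"
proof -
  \<comment> \<open>Order \<open>n\<close> controls exactly the iterates with \<open>k < n\<close>;
    the iterate \<open>k\<close> is therefore reached from \<open>n = Suc k\<close>.\<close>
  have "n_times_differentiable n f \<longleftrightarrow>
      (\<forall>k<n. \<forall>t. ((\<lambda>g x. vector_derivative g (at x)) ^^ k) f differentiable (at t))"
    for n and f :: "real \<Rightarrow> complex"
    by (induction n arbitrary: f)
      (simp_all add: All_less_Suc2 funpow_Suc_right del: funpow.simps(2))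
  then show ?thesis
    unfolding smooth_torus_def by (metis lessI)
qed

lemma Cinf_TZ_const: "(\<lambda>t \<xi>. c) \<in> Cinf_TZ"
  by (simp add: Cinf_TZ_def smooth_torus_iff n_times_differentiable_const)

lemma Cinf_TZ_add: "f \<in> Cinf_TZ \<Longrightarrow> g \<in> Cinf_TZ \<Longrightarrow> (\<lambda>t \<xi>. f t \<xi> + g t \<xi>) \<in> Cinf_TZ"
  by (simp add: Cinf_TZ_def smooth_torus_iff n_times_differentiable_add)

lemma Cinf_TZ_mult: "f \<in> Cinf_TZ \<Longrightarrow> g \<in> Cinf_TZ \<Longrightarrow> (\<lambda>t \<xi>. f t \<xi> * g t \<xi>) \<in> Cinf_TZ"
  by (simp add: Cinf_TZ_def smooth_torus_iff n_times_differentiable_mult)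

lemma Cinf_TZ_diff:
  assumes "f \<in> Cinf_TZ" "g \<in> Cinf_TZ"
  shows "(\<lambda>t \<xi>. f t \<xi> - g t \<xi>) \<in> Cinf_TZ"
  using Cinf_TZ_add[OF assms(1) Cinf_TZ_mult[OF Cinf_TZ_const[of "-1"] assms(2)]] by simp

lemma Cinf_TZ_divide:
  "f \<in> Cinf_TZ \<Longrightarrow> g \<in> Cinf_TZ \<Longrightarrow> (\<And>t \<xi>. g t \<xi> \<noteq> 0) \<Longrightarrow> (\<lambda>t \<xi>. f t \<xi> / g t \<xi>) \<in> Cinf_TZ"
  by (simp add: Cinf_TZ_def smooth_torus_iff divide_inverse n_times_differentiable_mult
      n_times_differentiable_inverse)

lemma Cinf_TZ_sum:
  "(\<And>i. i \<in> I \<Longrightarrow> f i \<in> Cinf_TZ) \<Longrightarrow> (\<lambda>t \<xi>. \<Sum>i\<in>I. f i t \<xi>) \<in> Cinf_TZ"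
  by (induction I rule: infinite_finite_induct) (simp_all add: Cinf_TZ_const Cinf_TZ_add)

lemma smooth_mat_mat:
  assumes "\<And>i j. i < m \<Longrightarrow> j < m \<Longrightarrow> (\<lambda>t \<xi>. f t \<xi> i j) \<in> Cinf_TZ"
  shows "smooth_mat m (\<lambda>t \<xi>. Matrix.mat m m (\<lambda>(i, j). f t \<xi> i j))"
  using assms by (simp add: smooth_mat_def)

lemma smooth_mat_mult:
  assumes "smooth_mat m A" "smooth_mat m B"
  shows "smooth_mat m (\<lambda>t \<xi>. A t \<xi> * B t \<xi>)"
proof -
  have car: "A t \<xi> \<in> carrier_mat m m" "B t \<xi> \<in> carrier_mat m m" for t \<xi>
    using assms by (auto simp: smooth_mat_def)
  have "(\<lambda>t \<xi>. (A t \<xi> * B t \<xi>) $$ (i, j)) = (\<lambda>t \<xi>. \<Sum>l<m. A t \<xi> $$ (i, l) * B t \<xi> $$ (l, j))"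
    if "i < m" "j < m" for i j
    using that carrier_matD[OF car(1)] carrier_matD[OF car(2)]
    by (simp add: scalar_prod_def atLeast0LessThan)
  moreover have "(\<lambda>t \<xi>. \<Sum>l<m. A t \<xi> $$ (i, l) * B t \<xi> $$ (l, j)) \<in> Cinf_TZ"
    if "i < m" "j < m" for i j
    using assms that by (intro Cinf_TZ_sum Cinf_TZ_mult) (auto simp: smooth_mat_def)
  ultimately show ?thesis
    using mult_carrier_mat[OF car] by (simp add: smooth_mat_def)
qed

lemma smooth_mat_mult_vec:
  assumes "smooth_mat m A" "smooth_vec m v"
  shows "smooth_vec m (\<lambda>t \<xi>. A t \<xi> *\<^sub>v v t \<xi>)"
proof -
  have car: "A t \<xi> \<in> carrier_mat m m" "v t \<xi> \<in> carrier_vec m" for t \<xi>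
    using assms by (auto simp: smooth_mat_def smooth_vec_def)
  have "(\<lambda>t \<xi>. (A t \<xi> *\<^sub>v v t \<xi>) $ i) = (\<lambda>t \<xi>. \<Sum>l<m. A t \<xi> $$ (i, l) * v t \<xi> $ l)"
    if "i < m" for i
    using that carrier_matD[OF car(1)] carrier_vecD[OF car(2)]
    by (simp add: scalar_prod_def atLeast0LessThan)
  moreover have "(\<lambda>t \<xi>. \<Sum>l<m. A t \<xi> $$ (i, l) * v t \<xi> $ l) \<in> Cinf_TZ" if "i < m" for i
    using assms that by (intro Cinf_TZ_sum Cinf_TZ_mult) (auto simp: smooth_mat_def smooth_vec_def)
  ultimately show ?thesis
    using mult_mat_vec_carrier[OF car] by (simp add: smooth_vec_def)
qed

subsection \<open>Triangular matrices and eigenvalues\<close>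

text \<open>Each further factor moves the possible nonzero entries one diagonal up:
  \<open>N ^\<^sub>m k\<close> vanishes wherever \<open>j < i + k\<close>, which covers the whole
  matrix for \<open>k = m\<close>.\<close>

lemma strictly_upper_triangular_nilpotent:
  assumes N: "N \<in> carrier_mat m m"
    and zero: "\<And>i j. j \<le> i \<Longrightarrow> i < m \<Longrightarrow> N $$ (i, j) = 0"
  shows "nilpotent_mat N"
proof -
  have "(N ^\<^sub>m k) $$ (i, j) = 0" if "i < m" "j < m" "j < i + k" for k i j
    using that
  proof (induction k arbitrary: j)
    case 0
    then show ?case using N by simp
  next
    case (Suc k)
    \<comment> \<open>If \<open>l < i + k\<close>, the first factor is zero by induction; otherwise
      \<open>j \<le> i + k \<le> l\<close> and the second factor is zero.\<close>
    have "(N ^\<^sub>m k) $$ (i, l) * N $$ (l, j) = 0" if "l < m" for l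
      using Suc that zero[of j l] by (cases "l < i + k") auto
    then have "(\<Sum>l\<in>{0..<m}. (N ^\<^sub>m k) $$ (i, l) * N $$ (l, j)) = 0"
      by (intro sum.neutral) auto
    then show ?case
      using N Suc.prems by (simp add: scalar_prod_def)
  qed
  then have "N ^\<^sub>m m = 0\<^sub>m (dim_row N) (dim_row N)"
    using N by (intro eq_matI) auto
  then show ?thesis
    using N by (auto simp: nilpotent_mat_def)
qed

text \<open>This turns algebraic multiplicities of a triangular matrix into counts of diagonal
  entries.\<close>

lemma order_prod_linear_factors:
  fixes z :: "'a::idom"
  shows "order z (\<Prod>a\<leftarrow>as. [:- a, 1:]) = length (filter (\<lambda>a. a = z) as)"
proof (induction as)
  case (Cons a as)
  have "order z ([:- a, 1:] * (\<Prod>a\<leftarrow>as. [:- a, 1:])) =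
      order z [:- a, 1:] + order z (\<Prod>a\<leftarrow>as. [:- a, 1:])"
    by (rule order_mult) (auto simp: prod_list_zero_iff simp del: mult_pCons_left)
  also have "order z [:- a, 1:] = (if a = z then 1 else 0)"
    using order_linear_power[of z "- a" 1] by auto
  finally show ?case
    using Cons by simp
qed simp

text \<open>All other diagonal entries already agree with the list. If the last one differed, the
  value \<open>l m\<close> would occur less often on the diagonal than in the list, although both
  counts are its multiplicity.\<close>

lemma lists_eigenvalues_upper_triangular_last:
  assumes B: "B \<in> carrier_mat m m" "upper_triangular B" and "m \<ge> 1"
    and l: "lists_eigenvalues m B l"
    and diag: "\<And>i. i < m - 1 \<Longrightarrow> B $$ (i, i) = l (Suc i)"
  shows "B $$ (m - 1, m - 1) = l m"
proof (rule ccontr)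
  assume neq: "B $$ (m - 1, m - 1) \<noteq> l m"
  define D where "D = {i. i < m \<and> B $$ (i, i) = l m}"
  define L where "L = {i. i < m \<and> l (Suc i) = l m}"
  have "i \<in> L" if "i \<in> D" for i
  proof -
    have "i \<noteq> m - 1"
      using that neq by (auto simp: D_def)
    then show ?thesis
      using that diag[of i] by (auto simp: D_def L_def)
  qed
  moreover have "m - 1 \<in> L" "m - 1 \<notin> D"
    using \<open>m \<ge> 1\<close> neq by (auto simp: L_def D_def)
  moreover have "finite L"
    by (simp add: L_def)
  ultimately have "card D < card L"
    by (intro psubset_card_mono) auto
  moreover have "card D = order (l m) (char_poly B)"
    unfolding char_poly_upper_triangular[OF B] order_prod_linear_factors length_filter_conv_card
    using B by (auto simp: D_def diag_mat_def intro!: arg_cong[where f = card])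
  \<comment> \<open>Eigenvalues are numbered from 1 and matrix indices from 0, hence the image under
    \<open>Suc\<close>.\<close>
  moreover have "{i \<in> {1..m}. l i = l m} = Suc ` L"
    by (force simp: L_def image_iff Suc_le_eq gr0_conv_Suc)
  then have "order (l m) (char_poly B) = card L"
    using l[unfolded lists_eigenvalues_def, rule_format, of "l m"] by (simp add: card_image)
  ultimately show False
    by simp
qed

lemma mult_mat_eq_one:
  fixes A B C D :: "'a::semiring_1 mat"
  assumes A: "A \<in> carrier_mat m m" and B: "B \<in> carrier_mat m m"
    and C: "C \<in> carrier_mat m m" and D: "D \<in> carrier_mat m m"
    and "B * C = 1\<^sub>m m" "A * D = 1\<^sub>m m"
  shows "(A * B) * (C * D) = 1\<^sub>m m"
proof -
  have "(A * B) * (C * D) = A * ((B * C) * D)"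
    unfolding assoc_mult_mat[OF A B mult_carrier_mat[OF C D]] assoc_mult_mat[OF B C D] ..
  then show ?thesis
    using assms by (simp add: left_mult_one_mat[OF D])
qed

text \<open>A two-sided inverse rules out the result \<open>None\<close> of
  \<open>mat_inverse\<close>, and uniqueness of inverses fixes its value. Inverses can thus be
  exhibited instead of computed.\<close>

lemma inv_mat_eq:
  assumes "P \<in> carrier_mat m m" "Q \<in> carrier_mat m m" "P * Q = 1\<^sub>m m" "Q * P = 1\<^sub>m m"
  shows "inv_mat P = Q"
proof -
  have "P \<in> Units (ring_mat TYPE(complex) m b)"
    using assms by (auto simp: Units_def ring_mat_def)
  then obtain R where R: "mat_inverse P = Some R"
    using mat_inverse(1)[OF assms(1)] by fastforce
  then have RP: "R * P = 1\<^sub>m m" and Rc: "R \<in> carrier_mat m m"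
    using mat_inverse(2)[OF assms(1)] by auto
  have "R = R * (P * Q)"
    using Rc assms(3) by simp
  also have "\<dots> = Q"
    unfolding assoc_mult_mat[OF Rc assms(1,2), symmetric] RP using assms(2) by simp
  finally have "R = Q" .
  with R show ?thesis
    by simp
qed

subsection \<open>The elimination matrices\<close>

text \<open>This is a Gauss transformation (Frobenius matrix) with pivot column \<open>k\<close>,
  counted from 0. Only the multipliers \<open>c i\<close> with \<open>k < i < m\<close>
  enter.\<close>

definition elim_mat :: "nat \<Rightarrow> nat \<Rightarrow> (nat \<Rightarrow> 'a) \<Rightarrow> 'a::comm_ring_1 mat" where
  "elim_mat m k c = Matrix.mat m m
     (\<lambda>(i, j). if i = j then 1 else if j = k \<and> k < i then c i else 0)"

lemma elim_mat_carrier [simp]: "elim_mat m k c \<in> carrier_mat m m"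
  by (simp add: elim_mat_def)

text \<open>Multiplication from the left is a row operation: multiples of row \<open>k\<close> are
  added to the rows below it.\<close>

lemma elim_mat_mult_index:
  assumes "M \<in> carrier_mat m m" "i < m" "j < m"
  shows "(elim_mat m k c * M) $$ (i, j) = M $$ (i, j) + (if k < i then c i * M $$ (k, j) else 0)"
proof -
  have "(elim_mat m k c * M) $$ (i, j) = (\<Sum>l\<in>{0..<m}. elim_mat m k c $$ (i, l) * M $$ (l, j))"
    using assms by (simp add: scalar_prod_def elim_mat_def)
  also have "\<dots> = (\<Sum>l\<in>{0..<m}. (if l = i then M $$ (i, j) else 0) +
        (if l = k then if k < i then c i * M $$ (k, j) else 0 else 0))"
    using assms by (intro sum.cong) (auto simp: elim_mat_def)
  finally show ?thesis
    using assms by (simp add: sum.distrib)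
qed

text \<open>Multiplication from the right is a column operation: only column \<open>k\<close>
  changes, by a combination of the later columns.\<close>

lemma mult_elim_mat_index:
  assumes "M \<in> carrier_mat m m" "i < m" "j < m"
  shows "(M * elim_mat m k c) $$ (i, j) =
    M $$ (i, j) + (if j = k then \<Sum>l\<in>{Suc k..<m}. M $$ (i, l) * c l else 0)"
proof -
  have "(M * elim_mat m k c) $$ (i, j) =
      (\<Sum>l\<in>{0..<m}. (if l = j then M $$ (i, j) else 0) +
        (if j = k \<and> k < l then M $$ (i, l) * c l else 0))"
    using assms by (auto simp: elim_mat_def scalar_prod_def intro!: sum.cong)
  also have "\<dots> = M $$ (i, j) + (\<Sum>l\<in>{0..<m}. if j = k \<and> k < l then M $$ (i, l) * c l else 0)"
    using assms by (simp add: sum.distrib)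
  also have "(\<Sum>l\<in>{0..<m}. if j = k \<and> k < l then M $$ (i, l) * c l else 0) =
      (if j = k then \<Sum>l\<in>{Suc k..<m}. M $$ (i, l) * c l else 0)"
    by (auto simp: sum.If_cases intro!: sum.cong)
  finally show ?thesis .
qed

text \<open>The row operations leave row \<open>k\<close> alone, so the multipliers of two such
  matrices add up, and opposite ones cancel.\<close>

lemma elim_mat_inverse:
  assumes "\<And>i. k < i \<Longrightarrow> c i + d i = 0"
  shows "elim_mat m k c * elim_mat m k d = 1\<^sub>m m"
proof (rule eq_matI)
  fix i j assume "i < dim_row (1\<^sub>m m :: 'a mat)" "j < dim_col (1\<^sub>m m :: 'a mat)"
  then show "(elim_mat m k c * elim_mat m k d) $$ (i, j) = 1\<^sub>m m $$ (i, j)"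
    unfolding index_one_mat
    using elim_mat_mult_index[of "elim_mat m k d" m i j k c] assms[of i]
    by (auto simp: elim_mat_def add.commute)
qed (simp_all add: elim_mat_def)

lemma cscalar_prod_unit_vec:
  fixes v :: "complex vec"
  assumes "v \<in> carrier_vec d" "j < d"
  shows "v \<bullet>c unit_vec d j = v $ j"
proof -
  have "conjugate (unit_vec d j) = (unit_vec d j :: complex vec)"
    by (rule eq_vecI) (auto simp: unit_vec_def)
  then show ?thesis
    using assms by simp
qed

text \<open>The first entry of the projected vector is \<open>w $ k\<close>, so the quotients in the
  first column of \<open>S_tilde\<close> are the elimination multipliers for the pivot
  \<open>w $ k\<close>.\<close>

lemma S_block_eq_elim_mat:
  assumes w: "w \<in> carrier_vec m" and "k < m" and nz: "w $ k \<noteq> 0"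
  shows "S_block m (Suc k) (vec_last w (m - k)) = elim_mat m k (\<lambda>i. w $ i / w $ k)"
proof (rule eq_matI)
  let ?v = "vec_last w (m - k)"
  have v: "?v \<bullet>c unit_vec (m - k) j = w $ (k + j)" if "j < m - k" for j
    using that w \<open>k < m\<close> by (subst cscalar_prod_unit_vec) (auto simp: vec_last_def)
  have d: "m - Suc k + 1 = m - k"
    using \<open>k < m\<close> by simp
  have S: "S_tilde (m - k) ?v $$ (i, j) =
      (if j = 0 then w $ (k + i) / w $ k else if i = j then 1 else 0)"
    if "i < m - k" "j < m - k" for i j
    using that \<open>k < m\<close> v[of 0] v[of i]
    by (cases j) (auto simp: S_tilde_def mat_of_cols_index unit_vec_def)
  have dims: "S_tilde (m - k) ?v \<in> carrier_mat (m - k) (m - k)"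
    using \<open>k < m\<close> by (intro carrier_matI) (simp_all add: S_tilde_def)
  fix i j assume "i < dim_row (elim_mat m k (\<lambda>i. w $ i / w $ k))"
    "j < dim_col (elim_mat m k (\<lambda>i. w $ i / w $ k))"
  then have "i < m" "j < m"
    by (auto simp: elim_mat_def)
  then show "S_block m (Suc k) ?v $$ (i, j) = elim_mat m k (\<lambda>i. w $ i / w $ k) $$ (i, j)"
  proof (cases "i < k \<or> j < k")
    case True
    then show ?thesis
      using \<open>i < m\<close> \<open>j < m\<close> carrier_matD[OF dims] unfolding S_block_def d
      by (auto simp: elim_mat_def)
  next
    case False
    then obtain i' j' where ij: "i = k + i'" "j = k + j'"
      by (metis le_Suc_ex not_less)
    have "S_block m (Suc k) ?v $$ (i, j) = S_tilde (m - k) ?v $$ (i', j')"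
      using \<open>i < m\<close> \<open>j < m\<close> carrier_matD[OF dims] unfolding S_block_def d ij by simp
    \<comment> \<open>For \<open>i' = j' = 0\<close> the entry is \<open>w $ k / w $ k\<close>,
      which equals 1 only because the pivot is nonzero.\<close>
    also have "\<dots> = elim_mat m k (\<lambda>i. w $ i / w $ k) $$ (i, j)"
      using S[of i' j'] \<open>i < m\<close> \<open>j < m\<close> nz by (auto simp: ij elim_mat_def)
    finally show ?thesis .
  qed
next
  show "dim_row (S_block m (Suc k) (vec_last w (m - k))) = dim_row (elim_mat m k (\<lambda>i. w $ i / w $ k))"
    "dim_col (S_block m (Suc k) (vec_last w (m - k))) = dim_col (elim_mat m k (\<lambda>i. w $ i / w $ k))"
    using \<open>k < m\<close> by (auto simp: S_block_def S_tilde_def elim_mat_def)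
qed

section \<open>One step of the triangularization\<close>

definition triangular_upto :: "nat \<Rightarrow> nat \<Rightarrow> (nat \<Rightarrow> 'a) \<Rightarrow> 'a::zero mat \<Rightarrow> bool" where
  "triangular_upto m k l B \<longleftrightarrow>
     (\<forall>j<k. B $$ (j, j) = l (Suc j) \<and> (\<forall>i. j < i \<and> i < m \<longrightarrow> B $$ (i, j) = 0))"

text \<open>From row \<open>k\<close> on, the column operation turns column \<open>k\<close> into
  the eigenvector divided by its pivot, times the eigenvalue. The row operations then clear it below
  the diagonal. Earlier columns survive because row \<open>k\<close> is zero there.\<close>

lemma triangular_upto_step:
  fixes B :: "'a::field mat"
  assumes B: "B \<in> carrier_mat m m" and tri: "triangular_upto m k l B"
    and w: "w \<in> carrier_vec m" and eig: "B *\<^sub>v w = l (Suc k) \<cdot>\<^sub>v w"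
    and "k < m" and nz: "w $ k \<noteq> 0"
  shows "triangular_upto m (Suc k) l
    (elim_mat m k (\<lambda>i. - (w $ i / w $ k)) * (B * elim_mat m k (\<lambda>i. w $ i / w $ k)))"
proof -
  define C where "C = B * elim_mat m k (\<lambda>i. w $ i / w $ k)"
  have C: "C \<in> carrier_mat m m"
    using B by (auto simp: C_def intro: mult_carrier_mat)
  have colj: "C $$ (i, j) = B $$ (i, j)" if "i < m" "j < k" for i j
    using mult_elim_mat_index[OF B, of i j k] that \<open>k < m\<close> by (simp add: C_def)
  have colk: "C $$ (i, k) = l (Suc k) * (w $ i / w $ k)" if "k \<le> i" "i < m" for i
  proof -
    have "l (Suc k) * w $ i = (\<Sum>j\<in>{0..<m}. B $$ (i, j) * w $ j)"
      using arg_cong[OF eig, of "\<lambda>v. v $ i"] B w that by (simp add: scalar_prod_def)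
    \<comment> \<open>In rows \<open>i \<ge> k\<close> the first \<open>k\<close> columns of
      \<open>B\<close> vanish, so the upper entries of \<open>w\<close> do not contribute.\<close>
    also have "\<dots> = (\<Sum>j\<in>{k..<m}. B $$ (i, j) * w $ j)"
      using tri that by (intro sum.mono_neutral_right) (auto simp: triangular_upto_def)
    also have "\<dots> = B $$ (i, k) * w $ k + (\<Sum>j\<in>{Suc k..<m}. B $$ (i, j) * w $ j)"
      using \<open>k < m\<close> by (rule sum.atLeast_Suc_lessThan)
    finally show ?thesis
      using mult_elim_mat_index[OF B, of i k k] that \<open>k < m\<close> nz
      by (simp add: C_def add_divide_distrib sum_divide_distrib)
  qed
  show ?thesis
    unfolding C_def[symmetric] triangular_upto_def
  proof (intro allI impI)
    fix j assume "j < Suc k"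
    have ind: "(elim_mat m k (\<lambda>i. - (w $ i / w $ k)) * C) $$ (i, j) =
        C $$ (i, j) + (if k < i then - (w $ i / w $ k) * C $$ (k, j) else 0)" if "i < m" for i
      using elim_mat_mult_index[OF C that] \<open>j < Suc k\<close> \<open>k < m\<close> by simp
    show "(elim_mat m k (\<lambda>i. - (w $ i / w $ k)) * C) $$ (j, j) = l (Suc j) \<and>
        (\<forall>i. j < i \<and> i < m \<longrightarrow> (elim_mat m k (\<lambda>i. - (w $ i / w $ k)) * C) $$ (i, j) = 0)"
    proof (cases "j = k")
      case True
      then show ?thesis
        using \<open>k < m\<close> nz ind by (auto simp: colk)
    next
      case False
      then show ?thesis
        using \<open>j < Suc k\<close> \<open>k < m\<close> tri by (auto simp: ind colj triangular_upto_def)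
    qed
  qed
qed

section \<open>The accumulated transformations at a fixed point\<close>

primrec S_prod :: "nat \<Rightarrow> (nat \<Rightarrow> complex vec) \<Rightarrow> nat \<Rightarrow> complex mat" where
  "S_prod m h 0 = 1\<^sub>m m"
| "S_prod m h (Suc k) = S_prod m h k * S_block m (Suc k) (h_rec m h (Suc k))"

context
  fixes m :: nat and h :: "nat \<Rightarrow> complex vec"
  assumes h_carrier: "\<And>i. i \<in> {1..m - 1} \<Longrightarrow> h i \<in> carrier_vec m"
    and h_rec_nz: "\<And>i. i \<in> {1..m - 1} \<Longrightarrow> h_rec m h i \<bullet>c unit_vec (m - i + 1) 0 \<noteq> 0"
begin

text \<open>The first coordinate of the projected vector is coordinate \<open>k\<close> of the full
  one, so the hypothesis on \<open>h_rec\<close> says that the elimination never meets a zero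
  pivot.\<close>

lemma pivot_nonzero:
  assumes "k < m - 1" "S_inv_prod m h k \<in> carrier_mat m m"
  shows "(S_inv_prod m h k *\<^sub>v h (Suc k)) $ k \<noteq> 0"
proof -
  have w: "S_inv_prod m h k *\<^sub>v h (Suc k) \<in> carrier_vec m"
    using assms h_carrier[of "Suc k"] by (auto intro: mult_mat_vec_carrier)
  have "h_rec m h (Suc k) \<bullet>c unit_vec (m - k) 0 \<noteq> 0"
    using h_rec_nz[of "Suc k"] assms(1) by (simp add: Suc_diff_Suc)
  then have "h_rec m h (Suc k) $ 0 \<noteq> 0"
    using assms(1) by (subst (asm) cscalar_prod_unit_vec) (auto simp: h_rec_def)
  then show ?thesis
    using assms(1) carrier_vecD[OF w] by (simp add: h_rec_def vec_last_def)
qed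

text \<open>Both recursions become multiplication by explicit Gauss transformations. The dimension
  of \<open>S_inv_prod\<close> is assumed here and supplied by the induction in
  \<open>S_prod_inverse\<close>.\<close>

lemma S_prod_Suc_elim_mat:
  assumes k: "k < m - 1" and car: "S_inv_prod m h k \<in> carrier_mat m m"
  defines "w \<equiv> S_inv_prod m h k *\<^sub>v h (Suc k)"
  shows "S_prod m h (Suc k) = S_prod m h k * elim_mat m k (\<lambda>i. w $ i / w $ k)"
    and "S_inv_prod m h (Suc k) = elim_mat m k (\<lambda>i. - (w $ i / w $ k)) * S_inv_prod m h k"
proof -
  have w: "w \<in> carrier_vec m"
    using assms h_carrier[of "Suc k"] by (auto intro: mult_mat_vec_carrier)
  have "S_block m (Suc k) (h_rec m h (Suc k)) = elim_mat m k (\<lambda>i. w $ i / w $ k)"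
    using S_block_eq_elim_mat[OF w] pivot_nonzero[OF k car] k by (simp add: h_rec_def w_def)
  moreover have "inv_mat (elim_mat m k (\<lambda>i. w $ i / w $ k)) = elim_mat m k (\<lambda>i. - (w $ i / w $ k))"
    by (rule inv_mat_eq) (auto intro: elim_mat_inverse)
  ultimately show "S_prod m h (Suc k) = S_prod m h k * elim_mat m k (\<lambda>i. w $ i / w $ k)"
    and "S_inv_prod m h (Suc k) = elim_mat m k (\<lambda>i. - (w $ i / w $ k)) * S_inv_prod m h k"
    by (simp_all only: S_inv_prod_Suc S_prod.simps)
qed

lemma S_prod_inverse:
  assumes "k \<le> m - 1"
  shows "S_inv_prod m h k \<in> carrier_mat m m \<and> S_prod m h k \<in> carrier_mat m m \<and>
    S_inv_prod m h k * S_prod m h k = 1\<^sub>m m \<and> S_prod m h k * S_inv_prod m h k = 1\<^sub>m m"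
  using assms
proof (induction k)
  case (Suc k)
  define w where "w = S_inv_prod m h k *\<^sub>v h (Suc k)"
  let ?T = "S_inv_prod m h k" and ?S = "S_prod m h k"
  let ?P = "elim_mat m k (\<lambda>i. w $ i / w $ k)" and ?Q = "elim_mat m k (\<lambda>i. - (w $ i / w $ k))"
  have T: "?T \<in> carrier_mat m m" and S: "?S \<in> carrier_mat m m"
    and TS: "?T * ?S = 1\<^sub>m m" and ST: "?S * ?T = 1\<^sub>m m"
    using Suc.IH Suc.prems by simp_all
  have P: "?P \<in> carrier_mat m m" and Q: "?Q \<in> carrier_mat m m"
    and PQ: "?P * ?Q = 1\<^sub>m m" and QP: "?Q * ?P = 1\<^sub>m m"
    by (auto intro: elim_mat_inverse)
  have 1: "(?Q * ?T) * (?S * ?P) = 1\<^sub>m m"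
    by (rule mult_mat_eq_one[OF Q T S P TS QP])
  have 2: "(?S * ?P) * (?Q * ?T) = 1\<^sub>m m"
    by (rule mult_mat_eq_one[OF S P Q T PQ ST])
  have "k < m - 1"
    using Suc.prems by simp
  then show ?case
    unfolding S_prod_Suc_elim_mat[OF \<open>k < m - 1\<close> T] w_def[symmetric]
    using 1 2 mult_carrier_mat[OF S P] mult_carrier_mat[OF Q T] by blast
qed auto

text \<open>In the new coordinates the next eigenvector becomes \<open>w\<close>, an eigenvector of
  the conjugated matrix for the same eigenvalue, so \<open>triangular_upto_step\<close>
  applies.\<close>

lemma S_prod_triangular:
  assumes A: "A \<in> carrier_mat m m"
    and eig: "\<And>i. i \<in> {1..m - 1} \<Longrightarrow> A *\<^sub>v h i = l i \<cdot>\<^sub>v h i"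
    and "k \<le> m - 1"
  shows "triangular_upto m k l (S_inv_prod m h k * (A * S_prod m h k))"
  using assms(3)
proof (induction k)
  case 0
  then show ?case by (simp add: triangular_upto_def)
next
  case (Suc k)
  define w where "w = S_inv_prod m h k *\<^sub>v h (Suc k)"
  let ?T = "S_inv_prod m h k" and ?S = "S_prod m h k"
  let ?P = "elim_mat m k (\<lambda>i. w $ i / w $ k)" and ?Q = "elim_mat m k (\<lambda>i. - (w $ i / w $ k))"
  have k: "k < m - 1"
    using Suc.prems by simp
  have T: "?T \<in> carrier_mat m m" and S: "?S \<in> carrier_mat m m" and ST: "?S * ?T = 1\<^sub>m m"
    using S_prod_inverse[of k] k by auto
  have hk: "h (Suc k) \<in> carrier_vec m"
    using h_carrier[of "Suc k"] k by auto
  then have w: "w \<in> carrier_vec m"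
    using T by (auto simp: w_def intro: mult_mat_vec_carrier)
  have AS: "A * ?S \<in> carrier_mat m m" "?T * (A * ?S) \<in> carrier_mat m m"
    using A S T by (auto intro: mult_carrier_mat)
  have "?S *\<^sub>v w = (?S * ?T) *\<^sub>v h (Suc k)"
    unfolding w_def by (rule assoc_mult_mat_vec[OF S T hk, symmetric])
  then have Sw: "?S *\<^sub>v w = h (Suc k)"
    unfolding ST using hk by simp
  have "(?T * (A * ?S)) *\<^sub>v w = ?T *\<^sub>v (A *\<^sub>v h (Suc k))"
    unfolding assoc_mult_mat_vec[OF T AS(1) w] assoc_mult_mat_vec[OF A S w] Sw ..
  also have "\<dots> = l (Suc k) \<cdot>\<^sub>v w"
    using eig[of "Suc k"] k T hk by (simp add: w_def mult_mat_vec[of _ m m])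
  finally have "triangular_upto m (Suc k) l (?Q * ((?T * (A * ?S)) * ?P))"
    using triangular_upto_step[OF AS(2) Suc.IH w] pivot_nonzero[OF k T] k by (simp add: w_def)
  \<comment> \<open>Reassociating exhibits the conjugate by the enlarged products.\<close>
  also have "?Q * ((?T * (A * ?S)) * ?P) = (?Q * ?T) * (A * (?S * ?P))"
    unfolding assoc_mult_mat[OF T AS(1) elim_mat_carrier] assoc_mult_mat[OF A S elim_mat_carrier]
    by (rule assoc_mult_mat[OF elim_mat_carrier T, symmetric])
      (rule mult_carrier_mat[OF A mult_carrier_mat[OF S elim_mat_carrier]])
  finally show ?case
    using S_prod_Suc_elim_mat[OF k T] by (simp only: w_def)
qed

lemma S_prod_triangular_full:
  assumes A: "A \<in> carrier_mat m m"
    and eig: "\<And>i. i \<in> {1..m - 1} \<Longrightarrow> A *\<^sub>v h i = l i \<cdot>\<^sub>v h i"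
    and "m \<ge> 1" and l: "lists_eigenvalues m A l"
  shows "triangular_upto m m l (S_inv_prod m h (m - 1) * A * S_prod m h (m - 1))"
proof -
  let ?T = "S_inv_prod m h (m - 1)" and ?S = "S_prod m h (m - 1)"
  define B where "B = ?T * A * ?S"
  have TS: "?T \<in> carrier_mat m m" "?S \<in> carrier_mat m m" "?T * ?S = 1\<^sub>m m" "?S * ?T = 1\<^sub>m m"
    using S_prod_inverse[of "m - 1"] by auto
  have B: "B \<in> carrier_mat m m"
    using TS A by (auto simp: B_def intro: mult_carrier_mat)
  have tri: "triangular_upto m (m - 1) l B"
    unfolding B_def assoc_mult_mat[OF TS(1) A TS(2)] by (rule S_prod_triangular[OF A eig order_refl])
  \<comment> \<open>An entry below the diagonal lies in a column before \<open>m - 1\<close>, so the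
    first \<open>m - 1\<close> columns decide triangularity.\<close>
  then have "upper_triangular B"
    using B by (auto simp: upper_triangular_def triangular_upto_def)
  \<comment> \<open>Similarity preserves the characteristic polynomial, hence the eigenvalue list,
    which then determines the last diagonal entry.\<close>
  moreover have "similar_mat B A"
    using similar_matI[of B A ?T ?S m] A B TS by (simp add: B_def)
  then have "lists_eigenvalues m B l"
    using l by (simp add: lists_eigenvalues_def char_poly_similar)
  ultimately have "B $$ (m - 1, m - 1) = l m"
    using lists_eigenvalues_upper_triangular_last[OF B _ \<open>m \<ge> 1\<close>] tri
    by (simp add: triangular_upto_def)
  then show ?thesis
    using tri \<open>m \<ge> 1\<close> less_antisym[of _ "m - 1"] unfolding triangular_upto_def B_def[symmetric]
    by (metis One_nat_def Suc_pred' Suc_le_eq less_SucE not_less_eq)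
qed

end

section \<open>Smooth dependence on the point\<close>

lemma S_prod_smooth:
  assumes h: "\<And>i. i \<in> {1..m - 1} \<Longrightarrow> smooth_vec m (h i)"
    and nz: "\<And>i t \<xi>. i \<in> {1..m - 1} \<Longrightarrow>
           h_rec m (\<lambda>k. h k t \<xi>) i \<bullet>c unit_vec (m - i + 1) 0 \<noteq> 0"
    and "k \<le> m - 1"
  shows "smooth_mat m (\<lambda>t \<xi>. S_inv_prod m (\<lambda>k. h k t \<xi>) k) \<and>
    smooth_mat m (\<lambda>t \<xi>. S_prod m (\<lambda>k. h k t \<xi>) k)"
  using assms(3)
proof (induction k)
  case 0
  have "smooth_mat m (\<lambda>t \<xi>. 1\<^sub>m m)"
    unfolding one_mat_def by (intro smooth_mat_mat Cinf_TZ_const)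
  then show ?case by simp
next
  case (Suc k)
  then have k: "k < m - 1"
    by simp
  define w where "w t \<xi> = S_inv_prod m (\<lambda>k. h k t \<xi>) k *\<^sub>v h (Suc k) t \<xi>" for t \<xi>
  have car: "h i t \<xi> \<in> carrier_vec m" if "i \<in> {1..m - 1}" for i t \<xi>
    using h[OF that] by (auto simp: smooth_vec_def)
  have T: "S_inv_prod m (\<lambda>k. h k t \<xi>) k \<in> carrier_mat m m" for t \<xi>
    using Suc k by (auto simp: smooth_mat_def)
  \<comment> \<open>The inverse product is smooth by induction, and it alone determines the next
    multipliers from \<open>h\<close>.\<close>
  have "smooth_vec m w"
    unfolding w_def using Suc.IH h k by (intro smooth_mat_mult_vec) simp_all
  then have w: "(\<lambda>t \<xi>. w t \<xi> $ i) \<in> Cinf_TZ" if "i < m" for i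
    using that by (auto simp: smooth_vec_def)
  have "w t \<xi> $ k \<noteq> 0" for t \<xi>
    using pivot_nonzero[of m "\<lambda>k. h k t \<xi>", OF car nz k T] by (simp add: w_def)
  then have c: "(\<lambda>t \<xi>. w t \<xi> $ i / w t \<xi> $ k) \<in> Cinf_TZ" if "i < m" for i
    using that k by (intro Cinf_TZ_divide w) auto
  then have c': "(\<lambda>t \<xi>. - (w t \<xi> $ i / w t \<xi> $ k)) \<in> Cinf_TZ" if "i < m" for i
    using Cinf_TZ_diff[OF Cinf_TZ_const[of 0] c[OF that]] by simp
  \<comment> \<open>The case distinction concerns indices only, so each entry is either constant in
    the point or one of the multipliers.\<close>
  have elim: "smooth_mat m (\<lambda>t \<xi>. elim_mat m k (d t \<xi>))"
    if "\<And>i. i < m \<Longrightarrow> (\<lambda>t \<xi>. d t \<xi> i) \<in> Cinf_TZ" for d :: "real \<Rightarrow> int ^ 'a \<Rightarrow> nat \<Rightarrow> complex"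
    unfolding elim_mat_def
  proof (rule smooth_mat_mat)
    fix i j assume "i < m"
    then show "(\<lambda>t \<xi>. if i = j then 1 else if j = k \<and> k < i then d t \<xi> i else 0) \<in> Cinf_TZ"
      using that by (cases "i = j"; cases "j = k"; cases "k < i") (simp_all add: Cinf_TZ_const)
  qed
  have "S_prod m (\<lambda>k. h k t \<xi>) (Suc k) =
      S_prod m (\<lambda>k. h k t \<xi>) k * elim_mat m k (\<lambda>i. w t \<xi> $ i / w t \<xi> $ k)"
    and "S_inv_prod m (\<lambda>k. h k t \<xi>) (Suc k) =
      elim_mat m k (\<lambda>i. - (w t \<xi> $ i / w t \<xi> $ k)) * S_inv_prod m (\<lambda>k. h k t \<xi>) k" for t \<xi>
    unfolding w_def using S_prod_Suc_elim_mat[of m "\<lambda>k. h k t \<xi>", OF car nz k T] by blast+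
  note step = this
  have "smooth_mat m (\<lambda>t \<xi>. S_inv_prod m (\<lambda>k. h k t \<xi>) k)"
    "smooth_mat m (\<lambda>t \<xi>. S_prod m (\<lambda>k. h k t \<xi>) k)"
    using Suc by simp_all
  then show ?case
    unfolding step by (intro conjI smooth_mat_mult elim c c')
qed

section \<open>Smooth triangularization and the nilpotent part\<close>

theorem theorem4p1:
  fixes A :: "real \<Rightarrow> int ^ 'n::finite \<Rightarrow> complex mat"
    and lam :: "nat \<Rightarrow> real \<Rightarrow> int ^ 'n \<Rightarrow> complex"
    and h :: "nat \<Rightarrow> real \<Rightarrow> int ^ 'n \<Rightarrow> complex vec"
    and m :: nat
  assumes "m \<ge> 1"
    and "smooth_mat m A"
    and "\<And>t \<xi>. lists_eigenvalues m (A t \<xi>) (\<lambda>i. lam i t \<xi>)"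
    and "\<And>i. i \<in> {1..m} \<Longrightarrow> lam i \<in> Cinf_TZ"
    and "\<And>i t \<xi>. i \<in> {1..m - 1} \<Longrightarrow> eigenvector (A t \<xi>) (h i t \<xi>) (lam i t \<xi>)"
    and "\<And>i. i \<in> {1..m - 1} \<Longrightarrow> smooth_vec m (h i)"
    and "\<And>i t \<xi>. i \<in> {1..m - 1} \<Longrightarrow>
           h_rec m (\<lambda>k. h k t \<xi>) i \<bullet>c unit_vec (m - i + 1) 0 \<noteq> 0"
  shows "\<exists>S N. smooth_mat m S \<and> (\<forall>t \<xi>. invertible_mat (S t \<xi>)) \<and>
           smooth_mat m (\<lambda>t \<xi>. inv_mat (S t \<xi>)) \<and>
           smooth_mat m N \<and>
           (\<forall>t \<xi>. upper_triangular (N t \<xi>) \<and> nilpotent_mat (N t \<xi>)) \<and>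
           (\<forall>t \<xi>. inv_mat (S t \<xi>) * A t \<xi> * S t \<xi> =
                    mat_diag m (\<lambda>j. lam (j + 1) t \<xi>) + N t \<xi>)"
proof -
  define T where "T t \<xi> = S_inv_prod m (\<lambda>k. h k t \<xi>) (m - 1)" for t \<xi>
  define S where "S t \<xi> = S_prod m (\<lambda>k. h k t \<xi>) (m - 1)" for t \<xi>
  define B where "B t \<xi> = T t \<xi> * A t \<xi> * S t \<xi>" for t \<xi>
  define N where "N t \<xi> = Matrix.mat m m
    (\<lambda>(i, j). B t \<xi> $$ (i, j) - (if i = j then lam (j + 1) t \<xi> else 0))" for t \<xi>
  have A: "A t \<xi> \<in> carrier_mat m m" for t \<xi>
    using assms(2) by (auto simp: smooth_mat_def)
  have h: "h i t \<xi> \<in> carrier_vec m" if "i \<in> {1..m - 1}" for i t \<xi>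
    using assms(6)[OF that] by (auto simp: smooth_vec_def)
  have eig: "A t \<xi> *\<^sub>v h i t \<xi> = lam i t \<xi> \<cdot>\<^sub>v h i t \<xi>" if "i \<in> {1..m - 1}" for i t \<xi>
    using assms(5)[OF that] by (auto simp: eigenvector_def)
  have smooth: "smooth_mat m T" "smooth_mat m S"
    using S_prod_smooth[OF assms(6,7), of "m - 1"] unfolding T_def S_def by auto
  have inv: "T t \<xi> \<in> carrier_mat m m" "S t \<xi> \<in> carrier_mat m m"
    "T t \<xi> * S t \<xi> = 1\<^sub>m m" "S t \<xi> * T t \<xi> = 1\<^sub>m m" for t \<xi>
    using S_prod_inverse[of m "\<lambda>k. h k t \<xi>", OF h assms(7)] unfolding T_def S_def by auto
  have tri: "triangular_upto m m (\<lambda>i. lam i t \<xi>) (B t \<xi>)" for t \<xi>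
    using S_prod_triangular_full[of m "\<lambda>k. h k t \<xi>", OF h assms(7) A eig assms(1,3)]
    unfolding T_def S_def B_def .
  have B: "smooth_mat m B"
    unfolding B_def by (intro smooth_mat_mult smooth assms(2))
  \<comment> \<open>Smoothness of the inverse is inherited from \<open>T\<close> through this
    identity.\<close>
  have invS: "inv_mat (S t \<xi>) = T t \<xi>" for t \<xi>
    using inv by (intro inv_mat_eq)
  have "invertible_mat (S t \<xi>)" for t \<xi>
    using inv[of t \<xi>] by (auto simp: invertible_mat_def inverts_mat_def)
  moreover have "smooth_mat m N"
    unfolding N_def
  proof (rule smooth_mat_mat)
    fix i j assume "i < m" "j < m"
    then have "(\<lambda>t \<xi>. if i = j then lam (j + 1) t \<xi> else 0) \<in> Cinf_TZ"
      using assms(4)[of "j + 1"] by (cases "i = j") (simp_all add: Cinf_TZ_const)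
    then show "(\<lambda>t \<xi>. B t \<xi> $$ (i, j) - (if i = j then lam (j + 1) t \<xi> else 0)) \<in> Cinf_TZ"
      using B \<open>i < m\<close> \<open>j < m\<close> by (intro Cinf_TZ_diff) (auto simp: smooth_mat_def)
  qed
  \<comment> \<open>Subtracting the eigenvalues empties the diagonal, so \<open>N\<close> is
    strictly upper triangular and hence nilpotent.\<close>
  moreover have N0: "N t \<xi> $$ (i, j) = 0" if "j \<le> i" "i < m" for t \<xi> i j
    using that tri[of t \<xi>] by (cases "i = j") (auto simp: N_def triangular_upto_def)
  then have "upper_triangular (N t \<xi>) \<and> nilpotent_mat (N t \<xi>)" for t \<xi>
    using strictly_upper_triangular_nilpotent[of "N t \<xi>" m]
    by (auto simp: upper_triangular_def N_def)
  moreover have "T t \<xi> * A t \<xi> * S t \<xi> = mat_diag m (\<lambda>j. lam (j + 1) t \<xi>) + N t \<xi>" for t \<xi>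
    unfolding B_def[symmetric]
    using B by (intro eq_matI) (auto simp: N_def mat_diag_def smooth_mat_def)
  ultimately show ?thesis
    using smooth by (intro exI[of _ S] exI[of _ N]) (simp add: invS)
qed

end
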